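(* Consider the binary random graph affiliation mixture model with $Q\ge1$ groups, all $\pi_q>0$, and $\alpha\ne\beta$. Let $m_1=\mathbb E(X_{12})$, $m_2=\mathbb E(X_{12}X_{13})$, $m_3=\mathbb E(X_{12}X_{13}X_{23})$. Then $$2m_1^3-3m_1m_2+m_3=0\quad\text{if and only if}\quad Q=1.$$
   Context: Random graph mixture model: nodes have i.i.d. latent groups $Z_i\in\{1,\dots,Q\}$ with $\pi_q=\mathbb P(Z_i=q)$, $\sum_q\pi_q=1$; edge variables $X_{ij}$ ($i<j$) are conditionally independent given all $Z$'s, with law of $X_{ij}$ depending only on $(Z_i,Z_j)$. Binary affiliation model: $X_{ij}\in\{0,1\}$ with $\mathbb P(X_{ij}=1\mid Z_i=q,Z_j=l)=\alpha$ if $q=l$ and $=\beta$ if $q\ne l$ (when $Q=1$ only $\alpha$ is used). *)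

theory Defs
  imports "HOL-Probability.Probability"
begin

definition aff_conn :: "real \<Rightarrow> real \<Rightarrow> nat \<Rightarrow> nat \<Rightarrow> real" where
  "aff_conn \<alpha> \<beta> q l = (if q = l then \<alpha> else \<beta>)"

definition aff_triple :: "nat pmf \<Rightarrow> real \<Rightarrow> real \<Rightarrow> (bool \<times> bool \<times> bool) pmf" where
  "aff_triple \<pi> \<alpha> \<beta> =
     do { z1 \<leftarrow> \<pi>; z2 \<leftarrow> \<pi>; z3 \<leftarrow> \<pi>;
          x12 \<leftarrow> bernoulli_pmf (aff_conn \<alpha> \<beta> z1 z2);
          x13 \<leftarrow> bernoulli_pmf (aff_conn \<alpha> \<beta> z1 z3);
          x23 \<leftarrow> bernoulli_pmf (aff_conn \<alpha> \<beta> z2 z3);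
          return_pmf (x12, x13, x23) }"

definition aff_m1 :: "nat pmf \<Rightarrow> real \<Rightarrow> real \<Rightarrow> real" where
  "aff_m1 \<pi> \<alpha> \<beta> = measure_pmf.expectation (aff_triple \<pi> \<alpha> \<beta>)
     (\<lambda>(x12, x13, x23). of_bool x12)"

definition aff_m2 :: "nat pmf \<Rightarrow> real \<Rightarrow> real \<Rightarrow> real" where
  "aff_m2 \<pi> \<alpha> \<beta> = measure_pmf.expectation (aff_triple \<pi> \<alpha> \<beta>)
     (\<lambda>(x12, x13, x23). of_bool x12 * of_bool x13)"

definition aff_m3 :: "nat pmf \<Rightarrow> real \<Rightarrow> real \<Rightarrow> real" where
  "aff_m3 \<pi> \<alpha> \<beta> = measure_pmf.expectation (aff_triple \<pi> \<alpha> \<beta>)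
     (\<lambda>(x12, x13, x23). of_bool x12 * of_bool x13 * of_bool x23)"

end

theory Submission
  imports Defs
begin

(* Write p_a = pmf pi a for the group weights and d = alpha - beta.
   The connection probability is affine in the indicator of "same group":
   aff_conn alpha beta a b = beta + d [a = b].  Hence each edge moment is the mean,
   over three i.i.d. latent groups (a, b, c), of a polynomial in the diagonal
   indicators [a = b], [a = c], [b = c], and [a = b = c].  Their means are the
   collision sums s2 = sum_a p_a^2 and s3 = sum_a p_a^3, which gives
     m1 = beta + d s2,  m2 = beta^2 + 2 beta d s2 + d^2 s3,
     m3 = beta^3 + 3 beta^2 d s2 + (3 beta d^2 + d^3) s3,
   and therefore 2 m1^3 - 3 m1 m2 + m3 = d^3 (2 s2^3 - 3 s2 s3 + s3). *)

(* Expectations over a bind with a finite result type can be computed iteratively;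
   this lets the simplifier unfold the sampling program aff_triple. *)

lemma expectation_bind_pmf_finite:
  fixes f :: "'b::finite \<Rightarrow> real"
  shows "measure_pmf.expectation (bind_pmf M N) f =
         measure_pmf.expectation M (\<lambda>x. measure_pmf.expectation (N x) f)"
  unfolding measure_pmf_bind
  by (rule integral_bind[where K="count_space UNIV" and B="\<Sum>y\<in>UNIV. \<bar>f y\<bar>" and B'=1])
     (auto intro: member_le_sum measure_pmf.finite_measure simp: measure_pmf_in_subprob_algebra)

definition triple_mean :: "'a pmf \<Rightarrow> ('a \<Rightarrow> 'a \<Rightarrow> 'a \<Rightarrow> real) \<Rightarrow> real" where
  "triple_mean \<pi> g = measure_pmf.expectation \<pi> (\<lambda>a. measure_pmf.expectation \<pi> (\<lambda>b.
       measure_pmf.expectation \<pi> (\<lambda>c. g a b c)))"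

(* The collision sums s_k = sum of p_a^k; s2 is the probability that two
   independent draws coincide, s3 that three do. *)
definition collision :: "'a pmf \<Rightarrow> nat \<Rightarrow> real" where
  "collision \<pi> k = (\<Sum>a\<in>set_pmf \<pi>. pmf \<pi> a ^ k)"

lemma expectation_pmf_power:
  assumes "finite (set_pmf \<pi>)"
  shows "measure_pmf.expectation \<pi> (\<lambda>a. pmf \<pi> a ^ k) = collision \<pi> (k + 1)"
  unfolding collision_def using assms
  by (subst integral_measure_pmf_real[of "set_pmf \<pi>"]) (auto simp: mult.commute)

lemma expectation_point_indicator:
  "measure_pmf.expectation \<pi> (\<lambda>c. of_bool (a = c)) = pmf \<pi> a"
  by (subst integral_measure_pmf_real[of "{a}"]) auto

(* Linearity of the triple mean (integrability is automatic for finite support). *)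
lemma triple_mean_add:
  assumes "finite (set_pmf \<pi>)"
  shows "triple_mean \<pi> (\<lambda>a b c. f a b c + g a b c) = triple_mean \<pi> f + triple_mean \<pi> g"
  unfolding triple_mean_def using assms
  by (simp add: integrable_measure_pmf_finite)

lemma triple_mean_scale:
  "triple_mean \<pi> (\<lambda>a b c. k * f a b c) = k * triple_mean \<pi> f"
  unfolding triple_mean_def by simp

lemma triple_mean_const: "triple_mean \<pi> (\<lambda>a b c. k) = k"
  unfolding triple_mean_def by simp

lemma triple_mean_diagonals:
  assumes "finite (set_pmf \<pi>)"
  shows "triple_mean \<pi> (\<lambda>a b c. of_bool (a = b)) = collision \<pi> 2"
    "triple_mean \<pi> (\<lambda>a b c. of_bool (a = c)) = collision \<pi> 2"
    "triple_mean \<pi> (\<lambda>a b c. of_bool (b = c)) = collision \<pi> 2"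
    "triple_mean \<pi> (\<lambda>a b c. of_bool (a = b \<and> a = c)) = collision \<pi> 3"
proof -
  have E2: "measure_pmf.expectation \<pi> (pmf \<pi>) = collision \<pi> 2"
    using expectation_pmf_power[OF assms, of 1] by (simp add: numeral_2_eq_2)
  have E3: "measure_pmf.expectation \<pi> (\<lambda>a. pmf \<pi> a * pmf \<pi> a) = collision \<pi> 3"
    using expectation_pmf_power[OF assms, of 2] by (simp add: power2_eq_square numeral_3_eq_3)
  have diag: "measure_pmf.expectation \<pi> (\<lambda>b. measure_pmf.expectation \<pi>
      (\<lambda>c. of_bool (a = b \<and> a = c))) = pmf \<pi> a * pmf \<pi> a" for a
  proof -
    have "(\<lambda>b. measure_pmf.expectation \<pi> (\<lambda>c. of_bool (a = b \<and> a = c)))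
        = (\<lambda>b. of_bool (a = b) * pmf \<pi> a)"
      by (auto simp: expectation_point_indicator)
    then show ?thesis by (simp add: expectation_point_indicator)
  qed
  show "triple_mean \<pi> (\<lambda>a b c. of_bool (a = b)) = collision \<pi> 2"
    "triple_mean \<pi> (\<lambda>a b c. of_bool (a = c)) = collision \<pi> 2"
    "triple_mean \<pi> (\<lambda>a b c. of_bool (b = c)) = collision \<pi> 2"
    "triple_mean \<pi> (\<lambda>a b c. of_bool (a = b \<and> a = c)) = collision \<pi> 3"
    by (simp_all add: triple_mean_def expectation_point_indicator diag E2 E3)
qed

lemma aff_conn_diagonal: "aff_conn \<alpha> \<beta> a b = \<beta> + (\<alpha> - \<beta>) * of_bool (a = b)"
  by (simp add: aff_conn_def)

lemma aff_conn_wedge: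
  "aff_conn \<alpha> \<beta> a b * aff_conn \<alpha> \<beta> a c =
     \<beta>\<^sup>2 + \<beta> * (\<alpha> - \<beta>) * (of_bool (a = b) + of_bool (a = c))
     + (\<alpha> - \<beta>)\<^sup>2 * of_bool (a = b \<and> a = c)"
  by (simp add: aff_conn_def power2_eq_square algebra_simps)

lemma aff_conn_triangle:
  "aff_conn \<alpha> \<beta> a b * aff_conn \<alpha> \<beta> a c * aff_conn \<alpha> \<beta> b c =
     \<beta> ^ 3 + \<beta>\<^sup>2 * (\<alpha> - \<beta>) * (of_bool (a = b) + of_bool (a = c) + of_bool (b = c))
     + (3 * \<beta> * (\<alpha> - \<beta>)\<^sup>2 + (\<alpha> - \<beta>) ^ 3) * of_bool (a = b \<and> a = c)"
  by (simp add: aff_conn_def power2_eq_square power3_eq_cube algebra_simps)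

lemma aff_moments_triple_mean:
  assumes "0 \<le> \<alpha>" "\<alpha> \<le> 1" "0 \<le> \<beta>" "\<beta> \<le> 1"
  shows "aff_m1 \<pi> \<alpha> \<beta> = triple_mean \<pi> (\<lambda>a b c. aff_conn \<alpha> \<beta> a b)"
    and "aff_m2 \<pi> \<alpha> \<beta> = triple_mean \<pi> (\<lambda>a b c. aff_conn \<alpha> \<beta> a b * aff_conn \<alpha> \<beta> a c)"
    and "aff_m3 \<pi> \<alpha> \<beta> =
           triple_mean \<pi> (\<lambda>a b c. aff_conn \<alpha> \<beta> a b * aff_conn \<alpha> \<beta> a c * aff_conn \<alpha> \<beta> b c)"
proof -
  have [simp]: "0 \<le> aff_conn \<alpha> \<beta> q l" "aff_conn \<alpha> \<beta> q l \<le> 1" for q l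
    using assms by (auto simp: aff_conn_def)
  show "aff_m1 \<pi> \<alpha> \<beta> = triple_mean \<pi> (\<lambda>a b c. aff_conn \<alpha> \<beta> a b)"
    "aff_m2 \<pi> \<alpha> \<beta> = triple_mean \<pi> (\<lambda>a b c. aff_conn \<alpha> \<beta> a b * aff_conn \<alpha> \<beta> a c)"
    "aff_m3 \<pi> \<alpha> \<beta> =
       triple_mean \<pi> (\<lambda>a b c. aff_conn \<alpha> \<beta> a b * aff_conn \<alpha> \<beta> a c * aff_conn \<alpha> \<beta> b c)"
    unfolding aff_m1_def aff_m2_def aff_m3_def aff_triple_def triple_mean_def
    by (simp_all add: expectation_bind_pmf_finite)
qed

lemma aff_moments:
  assumes "finite (set_pmf \<pi>)" "0 \<le> \<alpha>" "\<alpha> \<le> 1" "0 \<le> \<beta>" "\<beta> \<le> 1"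
  defines "d \<equiv> \<alpha> - \<beta>" and "s2 \<equiv> collision \<pi> 2" and "s3 \<equiv> collision \<pi> 3"
  shows "aff_m1 \<pi> \<alpha> \<beta> = \<beta> + d * s2"
    and "aff_m2 \<pi> \<alpha> \<beta> = \<beta>\<^sup>2 + 2 * \<beta> * d * s2 + d\<^sup>2 * s3"
    and "aff_m3 \<pi> \<alpha> \<beta> = \<beta> ^ 3 + 3 * \<beta>\<^sup>2 * d * s2 + (3 * \<beta> * d\<^sup>2 + d ^ 3) * s3"
proof -
  note linearity = triple_mean_add[OF assms(1)] triple_mean_scale triple_mean_const
    triple_mean_diagonals[OF assms(1)]
  note as_mean = aff_moments_triple_mean[OF assms(2-5)]
  show "aff_m1 \<pi> \<alpha> \<beta> = \<beta> + d * s2"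
    unfolding as_mean aff_conn_diagonal by (simp add: linearity d_def s2_def)
  have "aff_m2 \<pi> \<alpha> \<beta> = \<beta>\<^sup>2 + \<beta> * d * (s2 + s2) + d\<^sup>2 * s3"
    unfolding as_mean aff_conn_wedge by (simp add: linearity d_def s2_def s3_def)
  then show "aff_m2 \<pi> \<alpha> \<beta> = \<beta>\<^sup>2 + 2 * \<beta> * d * s2 + d\<^sup>2 * s3"
    by simp
  have "aff_m3 \<pi> \<alpha> \<beta> = \<beta> ^ 3 + \<beta>\<^sup>2 * d * (s2 + s2 + s2) + (3 * \<beta> * d\<^sup>2 + d ^ 3) * s3"
    unfolding as_mean aff_conn_triangle by (simp add: linearity d_def s2_def s3_def)
  then show "aff_m3 \<pi> \<alpha> \<beta> = \<beta> ^ 3 + 3 * \<beta>\<^sup>2 * d * s2 + (3 * \<beta> * d\<^sup>2 + d ^ 3) * s3"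
    by simp
qed

lemma aff_moment_combination:
  assumes "finite (set_pmf \<pi>)" "0 \<le> \<alpha>" "\<alpha> \<le> 1" "0 \<le> \<beta>" "\<beta> \<le> 1"
  shows "2 * aff_m1 \<pi> \<alpha> \<beta> ^ 3 - 3 * aff_m1 \<pi> \<alpha> \<beta> * aff_m2 \<pi> \<alpha> \<beta> + aff_m3 \<pi> \<alpha> \<beta>
    = (\<alpha> - \<beta>) ^ 3 * (2 * collision \<pi> 2 ^ 3 - 3 * collision \<pi> 2 * collision \<pi> 3 + collision \<pi> 3)"
  unfolding aff_moments[OF assms] by (simp add: algebra_simps power2_eq_square power3_eq_cube)

lemma collision_point_mass:
  assumes "set_pmf \<pi> = {x}"
  shows "collision \<pi> k = 1"
proof -
  have "pmf \<pi> x = 1"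
    using sum_pmf_eq_1[of "{x}" \<pi>] assms by simp
  then show ?thesis
    using assms by (simp add: collision_def)
qed

lemma pmf_lt_1_if_two_points:
  assumes "finite (set_pmf \<pi>)" "b \<in> set_pmf \<pi>" "a \<noteq> b"
  shows "pmf \<pi> a < 1"
proof -
  have "pmf \<pi> a + pmf \<pi> b \<le> (\<Sum>x\<in>set_pmf \<pi> \<union> {a}. pmf \<pi> x)"
    using assms by (subst sum.subset_diff[of "{a, b}"]) (auto intro!: sum_nonneg)
  also have "\<dots> = 1"
    using assms by (intro sum_pmf_eq_1) auto
  finally show ?thesis
    using pmf_positive[OF assms(2)] by linarith
qed

(* With at least two support points: 0 < s2 < 1, and since every p_a is at most
   sqrt s2, also s3 <= sqrt s2 * s2. *)
lemma collision_bounds: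
  assumes fin: "finite (set_pmf \<pi>)" and ab: "a \<in> set_pmf \<pi>" "b \<in> set_pmf \<pi>" "a \<noteq> b"
  shows "0 < collision \<pi> 2" and "collision \<pi> 2 < 1"
    and "0 \<le> collision \<pi> 3" and "collision \<pi> 3 \<le> sqrt (collision \<pi> 2) * collision \<pi> 2"
proof -
  let ?S = "set_pmf \<pi>" and ?p = "pmf \<pi>"
  have pos: "0 < ?p x" if "x \<in> ?S" for x
    using that by (rule pmf_positive)
  have lt1: "?p x < 1" for x
    using pmf_lt_1_if_two_points[OF fin] ab by (cases "x = a") auto
  show "0 < collision \<pi> 2"
    unfolding collision_def using fin ab(1) pos[OF ab(1)] by (intro sum_pos2[of _ a]) auto
  have "collision \<pi> 2 < (\<Sum>x\<in>?S. ?p x)"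
    unfolding collision_def using fin ab(1) pos lt1
    by (intro sum_strict_mono) (auto simp: power2_eq_square)
  also have "\<dots> = 1"
    using fin by (intro sum_pmf_eq_1) auto
  finally show "collision \<pi> 2 < 1" .
  show "0 \<le> collision \<pi> 3"
    unfolding collision_def by (intro sum_nonneg) auto
  have max_le: "?p x \<le> sqrt (collision \<pi> 2)" if "x \<in> ?S" for x
  proof -
    have "?p x ^ 2 \<le> collision \<pi> 2"
      unfolding collision_def using fin that by (intro member_le_sum) auto
    then show ?thesis by (simp add: real_le_rsqrt)
  qed
  have "collision \<pi> 3 = (\<Sum>x\<in>?S. ?p x * ?p x ^ 2)"
    by (simp add: collision_def power3_eq_cube power2_eq_square mult.assoc)
  also have "\<dots> \<le> (\<Sum>x\<in>?S. sqrt (collision \<pi> 2) * ?p x ^ 2)"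
    using max_le by (intro sum_mono mult_right_mono) auto
  also have "\<dots> = sqrt (collision \<pi> 2) * collision \<pi> 2"
    by (simp add: collision_def sum_distrib_left)
  finally show "collision \<pi> 3 \<le> sqrt (collision \<pi> 2) * collision \<pi> 2" .
qed

(* The gap is affine in s3 with slope 1 - 3 s2; it is positive at s3 = 0 and,
   writing s2 = t^2, equals t^3 (t - 1)^2 (2t + 1) > 0 at s3 = t s2. *)
lemma cubic_gap_pos:
  fixes s2 s3 :: real
  assumes "0 < s2" "s2 < 1" "0 \<le> s3" "s3 \<le> sqrt s2 * s2"
  shows "0 < 2 * s2 ^ 3 - 3 * s2 * s3 + s3"
proof (cases "3 * s2 \<le> 1")
  case True
  have "0 \<le> s3 * (1 - 3 * s2)" and "0 < s2 ^ 3"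
    using True assms by simp_all
  moreover have "2 * s2 ^ 3 - 3 * s2 * s3 + s3 = 2 * s2 ^ 3 + s3 * (1 - 3 * s2)"
    by (simp add: algebra_simps)
  ultimately show ?thesis by linarith
next
  case False
  define t where "t = sqrt s2"
  have t: "0 < t" "t < 1" "s2 = t\<^sup>2"
    using assms(1,2) by (simp_all add: t_def)
  have "s3 * (3 * s2 - 1) \<le> t * s2 * (3 * s2 - 1)"
    using False assms(4) by (intro mult_right_mono) (simp_all add: t_def)
  moreover have "2 * s2 ^ 3 - t * s2 * (3 * s2 - 1) = t ^ 3 * ((t - 1)\<^sup>2 * (2 * t + 1))"
    unfolding t(3) by (simp add: algebra_simps power2_eq_square power3_eq_cube)
  moreover have "0 < t ^ 3 * ((t - 1)\<^sup>2 * (2 * t + 1))"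
    using t by (intro mult_pos_pos) auto
  ultimately show ?thesis by (simp add: algebra_simps)
qed

lemma collision_gap_zero_iff:
  assumes fin: "finite (set_pmf \<pi>)"
  shows "2 * collision \<pi> 2 ^ 3 - 3 * collision \<pi> 2 * collision \<pi> 3 + collision \<pi> 3 = 0
    \<longleftrightarrow> (\<exists>x. set_pmf \<pi> = {x})"
proof
  assume gap: "2 * collision \<pi> 2 ^ 3 - 3 * collision \<pi> 2 * collision \<pi> 3 + collision \<pi> 3 = 0"
  show "\<exists>x. set_pmf \<pi> = {x}"
  proof (rule ccontr)
    assume "\<nexists>x. set_pmf \<pi> = {x}"
    moreover obtain a where a: "a \<in> set_pmf \<pi>"
      using set_pmf_not_empty[of \<pi>] by blast
    ultimately obtain b where "b \<in> set_pmf \<pi>" "a \<noteq> b"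
      by blast
    from collision_bounds[OF fin a this] gap show False
      using cubic_gap_pos by fastforce
  qed
qed (auto simp: collision_point_mass)

theorem proposition2:
  fixes \<pi> :: "nat pmf" and Q :: nat and \<alpha> \<beta> :: real
  assumes "Q \<ge> 1"
    and "set_pmf \<pi> = {1..Q}"
    and "0 \<le> \<alpha>" "\<alpha> \<le> 1" "0 \<le> \<beta>" "\<beta> \<le> 1"
    and "\<alpha> \<noteq> \<beta>"
  shows "2 * aff_m1 \<pi> \<alpha> \<beta> ^ 3 - 3 * aff_m1 \<pi> \<alpha> \<beta> * aff_m2 \<pi> \<alpha> \<beta>
           + aff_m3 \<pi> \<alpha> \<beta> = 0 \<longleftrightarrow> Q = 1"
proof -
  have fin: "finite (set_pmf \<pi>)"
    using assms(2) by simp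
  have "(\<exists>x. set_pmf \<pi> = {x}) \<longleftrightarrow> Q = 1"
    using assms(1,2) by auto
  then show ?thesis
    using aff_moment_combination[OF fin assms(3-6)] collision_gap_zero_iff[OF fin] assms(7)
    by simp
qed

end
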